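(* Let $f:\mathbb{R}^n\to\mathbb{R}\cup\{+\infty\}$ be a convex function such that $f(x_1,\dots,x_n)\in(\mathbb{Z}+\mathbb{Z}x_1+\cdots+\mathbb{Z}x_n)\cup\{+\infty\}$ for all $(x_1,\dots,x_n)\in\mathbb{Q}^n$. Then $f$ is internally integral polyhedral.
   Context: $f:\mathbb{R}^n\to\mathbb{R}\cup\{+\infty\}$ is convex if $tf(x)+(1-t)f(y)\ge f(tx+(1-t)y)$ for all $x,y$, $t\in[0,1]$. $\mathrm{dom}(f)=\{x:f(x)<+\infty\}$ and $\mathrm{int\,dom}(f)$ is its interior. For $C\subseteq\mathbb{R}^n$, $\delta_C$ is $0$ on $C$ and $+\infty$ off $C$. An integral affine functional is $\lambda(x)=a_1x_1+\cdots+a_nx_n+b$ with $a_i,b\in\mathbb{Z}$; an integral generalized affine functional is either an integral affine functional or such a functional plus $\delta_H$ for a closed half-space $H=\{a_1x_1+\cdots+a_nx_n\le b\}$ with $a_i,b\in\mathbb{Z}$, not all $a_i$ zero. A function is integral polyhedral if it is the maximum of finitely many integral generalized affine functionals; a set $C$ is rational polyhedral if $\delta_C$ is integral polyhedral. $f$ is internally integral polyhedral if for every bounded rational polyhedral $C\subseteq\mathrm{int\,dom}(f)$, $f+\delta_C$ is integral polyhedral. *)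

theory Defs
  imports "HOL-Analysis.Analysis"
begin

text \<open>
  Functions with values in \<open>\<real> \<union> {+\<infinity>}\<close> are functions into \<^typ>\<open>ereal\<close> that never take
  the value \<open>-\<infinity>\<close>; that requirement is stated separately where it is needed.
\<close>

text \<open>
  In \<^typ>\<open>ereal\<close> one has \<open>0 * \<infinity> = 0\<close>. This convention only affects \<open>t = 0\<close> and \<open>t = 1\<close>,
  where the inequality holds trivially for functions avoiding \<open>-\<infinity>\<close>.
\<close>

definition ereal_convex :: "('a::real_vector \<Rightarrow> ereal) \<Rightarrow> bool" where
  "ereal_convex f \<longleftrightarrow>
     (\<forall>x y. \<forall>t\<in>{0..1::real}.
        f (t *\<^sub>R x + (1 - t) *\<^sub>R y) \<le> ereal t * f x + ereal (1 - t) * f y)"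

definition eff_dom :: "('a \<Rightarrow> ereal) \<Rightarrow> 'a set" where
  "eff_dom f = {x. f x < \<infinity>}"

definition delta :: "'a set \<Rightarrow> 'a \<Rightarrow> ereal" where
  "delta C x = (if x \<in> C then 0 else \<infinity>)"

definition int_linear :: "int ^ 'n \<Rightarrow> real ^ 'n \<Rightarrow> real" where
  "int_linear a x = (\<Sum>i\<in>UNIV. of_int (a $ i) * x $ i)"

definition int_halfspace :: "int ^ 'n \<Rightarrow> int \<Rightarrow> (real ^ 'n) set" where
  "int_halfspace a b = {x. int_linear a x \<le> of_int b}"

text \<open>The subgroup \<open>\<int> + \<int> x\<^sub>1 + \<dots> + \<int> x\<^sub>n\<close> of the real numbers.\<close>

definition int_combinations :: "real ^ 'n \<Rightarrow> real set" where
  "int_combinations x = {int_linear a x + of_int b | a b. True}"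

definition integral_affine :: "(real ^ 'n \<Rightarrow> ereal) \<Rightarrow> bool" where
  "integral_affine l \<longleftrightarrow> (\<exists>a b. l = (\<lambda>x. ereal (int_linear a x + of_int b)))"

definition integral_gen_affine :: "(real ^ 'n \<Rightarrow> ereal) \<Rightarrow> bool" where
  "integral_gen_affine g \<longleftrightarrow>
     integral_affine g \<or>
     (\<exists>l a b. integral_affine l \<and> a \<noteq> 0 \<and> g = (\<lambda>x. l x + delta (int_halfspace a b) x))"

definition integral_polyhedral :: "(real ^ 'n \<Rightarrow> ereal) \<Rightarrow> bool" where
  "integral_polyhedral f \<longleftrightarrow>
     (\<exists>G. finite G \<and> G \<noteq> {} \<and> (\<forall>g\<in>G. integral_gen_affine g) \<and>
          f = (\<lambda>x. MAX g\<in>G. g x))"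

definition rational_polyhedral :: "(real ^ 'n) set \<Rightarrow> bool" where
  "rational_polyhedral C \<longleftrightarrow> integral_polyhedral (delta C)"

definition internally_integral_polyhedral :: "(real ^ 'n \<Rightarrow> ereal) \<Rightarrow> bool" where
  "internally_integral_polyhedral f \<longleftrightarrow>
     (\<forall>C. bounded C \<and> rational_polyhedral C \<and> C \<subseteq> interior (eff_dom f) \<longrightarrow>
          integral_polyhedral (\<lambda>x. f x + delta C x))"

end

theory Submission
  imports Defs
begin

text \<open>
  In homogeneous coordinates, \<open>F(s, p) = s f(p / s)\<close> is sublinear on a cone of \<open>\<int>\<^sup>n\<^sup>+\<^sup>1\<close> and
  takes integer values there. At an interior lattice point \<open>p\<close> the sequence \<open>F(k p + q) - k F(p)\<close>
  of integers is decreasing and bounded below, hence eventually constant, so the directional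
  derivatives of \<open>F\<close> at \<open>p\<close> are integers. Differentiating the derivative again along each
  coordinate axis yields an integral linear form below \<open>F\<close> that agrees with \<open>F\<close> at \<open>p\<close>.
  Thus \<open>f\<close> has an integral affine support at every rational interior point. Near a point of the
  interior the slopes of these supports are bounded, so only finitely many of them occur; by
  density of the rational points and compactness, finitely many supports determine \<open>f\<close> on \<open>C\<close>.
\<close>

section \<open>Integer-valued sublinear functions on lattice cones\<close>

definition sublinear_on :: "(int ^ 'm) set \<Rightarrow> (int ^ 'm \<Rightarrow> int) \<Rightarrow> bool" where
  "sublinear_on K F \<longleftrightarrow>
     (\<forall>a\<in>K. \<forall>b\<in>K. a + b \<in> K \<and> F (a + b) \<le> F a + F b) \<and>
     (\<forall>a\<in>K. \<forall>n>0. n *s a \<in> K \<and> F (n *s a) = n * F a)"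

lemma sublinear_on_add:
  assumes "sublinear_on K F" "a \<in> K" "b \<in> K"
  shows "a + b \<in> K" "F (a + b) \<le> F a + F b"
  using assms unfolding sublinear_on_def by blast+

lemma sublinear_on_scale:
  assumes "sublinear_on K F" "a \<in> K" "n > 0"
  shows "n *s a \<in> K" "F (n *s a) = n * F a"
  using assms unfolding sublinear_on_def by blast+

text \<open>The values from \<open>N\<close> on attain a least one, at \<open>m\<close>. After
  \<open>m\<close> the sequence cannot rise, being decreasing, nor fall, by minimality.\<close>

lemma antimono_int_eventually_const:
  fixes d :: "nat \<Rightarrow> int"
  assumes "\<And>k. k \<ge> N \<Longrightarrow> d (Suc k) \<le> d k" and "\<And>k. k \<ge> N \<Longrightarrow> B \<le> d k"
  shows "\<exists>z. \<forall>\<^sub>F k in sequentially. d k = z"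
proof -
  obtain m where m: "m \<ge> N" "\<And>k. k \<ge> N \<Longrightarrow> nat (d m - B) \<le> nat (d k - B)"
    using ex_has_least_nat[of "\<lambda>k. k \<ge> N" N "\<lambda>k. nat (d k - B)"] by auto
  have "d k \<le> d m" if "k \<ge> m" for k
    using that by (induction k rule: dec_induct) (use assms(1) m(1) in \<open>auto intro: order_trans\<close>)
  moreover have "d m \<le> d k" if "k \<ge> m" for k
    using m(2)[of k] assms(2)[of k] assms(2)[of m] m(1) that by simp
  ultimately show ?thesis
    unfolding eventually_sequentially by (meson order_antisym)
qed

text \<open>The witness is the one-sided directional derivative at \<open>p\<close>:
  \<open>h q\<close> is the eventual value of \<open>F (int k *s p + q) - int k * F p\<close>. The
  last assumption places \<open>p\<close> in the algebraic interior of \<open>K\<close>, so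
  \<open>h\<close> exists in every lattice direction.\<close>

lemma sublinear_directional_derivative:
  fixes F :: "int ^ 'm \<Rightarrow> int"
  assumes F: "sublinear_on K F" and p: "p \<in> K"
    and absorbing: "\<And>q. \<forall>\<^sub>F k in sequentially. int k *s p + q \<in> K"
  shows "\<exists>h. sublinear_on UNIV h \<and> h p = F p \<and> h (- p) = - F p \<and> (\<forall>q\<in>K. h q \<le> F q)"
proof -
  define d where "d q k = F (int k *s p + q) - int k * F p" for q k
  have "\<exists>z. \<forall>\<^sub>F k in sequentially. d q k = z" for q
  proof -
    \<comment> \<open>Both signs of \<open>q\<close> occur in the lower bound, and
      \<open>N \<ge> 1\<close> makes the factor \<open>2 * int k\<close> positive.\<close>
    obtain N where N: "N \<ge> 1" "\<And>k. k \<ge> N \<Longrightarrow> int k *s p + q \<in> K" "\<And>k. k \<ge> N \<Longrightarrow> int k *s p + (- q) \<in> K"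
      using eventually_conj[OF eventually_conj[OF absorbing absorbing] eventually_ge_at_top[of 1], of q "- q"]
      unfolding eventually_sequentially by (metis (no_types, lifting) order_refl)
    have dec: "d r (Suc k) \<le> d r k" if "int k *s p + r \<in> K" for r k
    proof -
      have "int (Suc k) *s p + r = (int k *s p + r) + p"
        by (simp add: vec_eq_iff algebra_simps)
      then show ?thesis
        using sublinear_on_add(2)[OF F that p] by (simp add: d_def algebra_simps)
    qed
    have dec': "d (- q) k \<le> d (- q) N" if "k \<ge> N" for k
      using that
    proof (induction k rule: dec_induct)
      case (step k)
      then show ?case
        using dec[OF N(3)] by (meson order_trans)
    qed simp
    \<comment> \<open>\<open>int k *s p\<close> is the midpoint of \<open>int k *s p + q\<close> and
      \<open>int k *s p + (- q)\<close>, so \<open>d q k + d (- q) k\<close> is nonnegative; since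
      \<open>d (- q)\<close> decreases, \<open>d q\<close> is bounded below.\<close>
    have "- d (- q) N \<le> d q k" if "k \<ge> N" for k
    proof -
      have "(2 * int k) *s p = (int k *s p + q) + (int k *s p + (- q))"
        by (simp add: vec_eq_iff algebra_simps)
      moreover have "F ((2 * int k) *s p) = 2 * int k * F p"
        by (rule sublinear_on_scale[OF F p]) (use N that in simp)
      ultimately have "2 * int k * F p \<le> F (int k *s p + q) + F (int k *s p + (- q))"
        using sublinear_on_add(2)[OF F N(2,3)[OF that]] by argo
      then have "0 \<le> d q k + d (- q) k"
        unfolding d_def by linarith
      with dec'[OF that] show ?thesis by simp
    qed
    then show ?thesis
      using dec N(2) by (intro antimono_int_eventually_const[of N _ "- d (- q) N"]) auto
  qed
  then obtain h where h: "\<And>q. \<forall>\<^sub>F k in sequentially. d q k = h q"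
    by metis
  have "\<exists>N. \<forall>k\<ge>N. d q k = h q \<and> int k *s p + q \<in> K" for q
    using eventually_conj[OF h absorbing] unfolding eventually_sequentially .
  then obtain N where N: "\<And>q k. k \<ge> N q \<Longrightarrow> d q k = h q \<and> int k *s p + q \<in> K"
    by metis
  have "h (a + b) \<le> h a + h b" for a b
  proof -
    \<comment> \<open>The two base points add up to \<open>2 * k\<close> copies of \<open>p\<close>,
      so \<open>h (a + b)\<close> is read off at index \<open>2 * k\<close>.\<close>
    define k where "k = N a + N b + N (a + b)"
    have k: "k \<ge> N a" "k \<ge> N b" "2 * k \<ge> N (a + b)"
      by (auto simp: k_def)
    have "int (2 * k) *s p + (a + b) = (int k *s p + a) + (int k *s p + b)"
      by (simp add: vec_eq_iff algebra_simps)
    then have "F (int (2 * k) *s p + (a + b)) \<le> F (int k *s p + a) + F (int k *s p + b)"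
      using sublinear_on_add(2)[OF F, of "int k *s p + a" "int k *s p + b"] N k by simp
    then have "d (a + b) (2 * k) \<le> d a k + d b k"
      by (simp add: d_def del: vector_smult_assoc)
    then show ?thesis
      using N k by simp
  qed
  moreover have "h (n *s a) = n * h a" if n: "n > 0" for n a
  proof -
    \<comment> \<open>Scaling \<open>int k *s p + a\<close> by \<open>n\<close> also scales the
      index, so \<open>h (n *s a)\<close> is read off at \<open>nat n * k\<close>.\<close>
    define k where "k = N a + N (n *s a)"
    have "1 * k \<le> nat n * k"
      using n by (intro mult_right_mono) auto
    moreover have "k \<ge> N a" "k \<ge> N (n *s a)"
      by (auto simp: k_def)
    ultimately have k: "k \<ge> N a" "nat n * k \<ge> N (n *s a)"
      by linarith+
    have "int (nat n * k) *s p + n *s a = n *s (int k *s p + a)"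
      using n by (simp add: vec_eq_iff algebra_simps)
    then have "d (n *s a) (nat n * k) = n * d a k"
      using sublinear_on_scale(2)[OF F, of "int k *s p + a" n] N[OF k(1)] n
      by (simp add: d_def algebra_simps)
    then show ?thesis
      using N k by simp
  qed
  moreover have "h p = F p"
  proof -
    have "int (N p) *s p + p = (int (N p) + 1) *s p"
      by (simp add: vec_eq_iff algebra_simps)
    then have "d p (N p) = F p"
      using sublinear_on_scale(2)[OF F p, of "int (N p) + 1"] by (simp add: d_def algebra_simps)
    then show ?thesis
      using N by simp
  qed
  moreover have "h (- p) = - F p"
  proof -
    \<comment> \<open>The offset 2 keeps \<open>int ?k - 1\<close> positive even if
      \<open>N (- p) = 0\<close>.\<close>
    let ?k = "N (- p) + 2"
    have "int ?k *s p + (- p) = (int ?k - 1) *s p"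
      by (simp add: vec_eq_iff algebra_simps)
    then have "d (- p) ?k = - F p"
      using sublinear_on_scale(2)[OF F p, of "int ?k - 1"] by (simp add: d_def algebra_simps)
    then show ?thesis
      using N[of "- p" ?k] by simp
  qed
  moreover have "h q \<le> F q" if "q \<in> K" for q
  proof -
    let ?k = "N q + 1"
    have "F (int ?k *s p) = int ?k * F p" "int ?k *s p \<in> K"
      by (rule sublinear_on_scale[OF F p]; simp)+
    then have "d q ?k \<le> F q"
      using sublinear_on_add(2)[OF F, of "int ?k *s p" q] that by (simp add: d_def)
    then show ?thesis
      using N[of q ?k] by simp
  qed
  ultimately show ?thesis
    unfolding sublinear_on_def by (intro exI[of _ h]) auto
qed

text \<open>Hahn-Banach without division: taking the derivative at one unit vector after another
  lowers \<open>h\<close> and makes it odd on these vectors. Subadditivity then forces the result to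
  be the linear form with the same values on the unit vectors.\<close>

lemma integral_hahn_banach:
  fixes h :: "int ^ 'm \<Rightarrow> int"
  assumes "sublinear_on UNIV h"
  shows "\<exists>a. \<forall>v. (\<Sum>i\<in>UNIV. a $ i * v $ i) \<le> h v"
proof -
  have "\<exists>g. sublinear_on UNIV g \<and> (\<forall>v. g v \<le> h v) \<and> (\<forall>i\<in>S. g (- axis i 1) = - g (axis i 1))"
    for S :: "'m set"
    using finite[of S]
  proof (induction S rule: finite_induct)
    case empty
    then show ?case
      using assms by auto
  next
    case (insert j S)
    then obtain g where g: "sublinear_on UNIV g" "\<And>v. g v \<le> h v"
      and gS: "\<And>i. i \<in> S \<Longrightarrow> g (- axis i 1) = - g (axis i 1)"
      by auto
    obtain g' where g': "sublinear_on UNIV g'" "\<And>v. g' v \<le> g v"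
      and g'j: "g' (axis j 1) = g (axis j 1)" "g' (- axis j 1) = - g (axis j 1)"
      using sublinear_directional_derivative[OF g(1), of "axis j 1"] by auto
    \<comment> \<open>Oddness on the earlier axes survives: with \<open>e = axis i 1\<close>, the
      sum \<open>g' e + g' (- e)\<close> is nonnegative by subadditivity and at most
      \<open>g e + g (- e) = 0\<close> by domination. The value at 0 comes from
      \<open>2 *s 0 = 0\<close>.\<close>
    have "g' 0 = 0"
      using sublinear_on_scale(2)[OF g'(1), of 0 2] by simp
    then have "0 \<le> g' (axis i 1) + g' (- axis i 1)" for i
      using sublinear_on_add(2)[OF g'(1), of "axis i 1" "- axis i 1"] by simp
    then have "g' (- axis i 1) = - g' (axis i 1)" if "i \<in> S" for i
      using gS[OF that] g'(2)[of "axis i 1"] g'(2)[of "- axis i 1"] by (smt (verit))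
    then show ?case
      using g'(1) g'j order_trans[OF g'(2) g(2)] by (intro exI[of _ g']) auto
  qed
  from this[of UNIV] obtain g where g: "sublinear_on UNIV g" "\<And>v. g v \<le> h v"
    and sym: "\<And>i. g (- axis i 1) = - g (axis i 1)"
    by auto
  have g0: "g 0 = 0"
    using sublinear_on_scale(2)[OF g(1), of 0 2] by simp
  have g_axis: "g (c *s axis i 1) = c * g (axis i 1)" for c i
  proof (cases c "0 :: int" rule: linorder_cases)
    case less
    have "c *s axis i 1 = (- c) *s (- axis i (1::int))"
      by (simp add: vec_eq_iff)
    then show ?thesis
      using sublinear_on_scale(2)[OF g(1), of "- axis i 1" "- c"] less sym by simp
  qed (use sublinear_on_scale(2)[OF g(1)] g0 in auto)
  have g_sum: "g (\<Sum>i\<in>S. u i) \<le> (\<Sum>i\<in>S. g (u i))" if "finite S" for S and u :: "'m \<Rightarrow> int ^ 'm"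
    using that
  proof (induction S rule: finite_induct)
    case (insert i S)
    then show ?case
      using sublinear_on_add(2)[OF g(1), of "u i" "\<Sum>i\<in>S. u i"] by simp
  qed (simp add: g0)
  define a where "a = (\<chi> i. g (axis i 1))"
  have le: "g v \<le> (\<Sum>i\<in>UNIV. a $ i * v $ i)" for v
    using g_sum[of UNIV "\<lambda>i. (v $ i) *s axis i 1"]
    by (simp add: basis_expansion g_axis a_def mult.commute)
  \<comment> \<open>Applying \<open>le\<close> to \<open>- v\<close> and using
    \<open>0 \<le> g v + g (- v)\<close> reverses the inequality.\<close>
  have "(\<Sum>i\<in>UNIV. a $ i * v $ i) \<le> g v" for v
    using le[of "- v"] sublinear_on_add(2)[OF g(1), of v "- v"] g0
    by (simp add: sum_negf)
  then show ?thesis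
    using g(2) order_trans by blast
qed

text \<open>A linear form below the derivative is at most \<open>F p\<close> at \<open>p\<close> and
  at most \<open>- F p\<close> at \<open>- p\<close>, which forces equality at
  \<open>p\<close>.\<close>

lemma sublinear_integral_support:
  fixes F :: "int ^ 'm \<Rightarrow> int"
  assumes "sublinear_on K F" "p \<in> K" "\<And>q. \<forall>\<^sub>F k in sequentially. int k *s p + q \<in> K"
  shows "\<exists>a. (\<Sum>i\<in>UNIV. a $ i * p $ i) = F p \<and> (\<forall>q\<in>K. (\<Sum>i\<in>UNIV. a $ i * q $ i) \<le> F q)"
proof -
  obtain h where h: "sublinear_on UNIV h" "h p = F p" "h (- p) = - F p" "\<And>q. q \<in> K \<Longrightarrow> h q \<le> F q"
    using sublinear_directional_derivative[OF assms] by blast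
  obtain a where a: "\<And>v. (\<Sum>i\<in>UNIV. a $ i * v $ i) \<le> h v"
    using integral_hahn_banach[OF h(1)] by blast
  show ?thesis
    using a[of p] a[of "- p"] h order_trans[OF a h(4)]
    by (intro exI[of _ a]) (auto simp: sum_negf)
qed

section \<open>Homogeneous coordinates of rational points\<close>

text \<open>The coordinate \<open>None\<close> is the homogenising one, i.e. the common denominator.\<close>

definition affine_point :: "int ^ ('n::finite option) \<Rightarrow> real ^ 'n" where
  "affine_point q = (\<chi> i. of_int (q $ Some i) / of_int (q $ None))"

lemma sum_option:
  fixes u :: "'n::finite option \<Rightarrow> 'a::comm_monoid_add"
  shows "(\<Sum>j\<in>UNIV. u j) = (\<Sum>i\<in>UNIV. u (Some i)) + u None"
  by (simp add: UNIV_option_conv sum.reindex add.commute)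

text \<open>The dictionary between linear forms on the lattice and affine functionals: clearing the
  denominator turns the constant term into the coefficient of the coordinate
  \<open>None\<close>.\<close>

lemma int_linear_affine_point:
  fixes a q :: "int ^ ('n::finite option)"
  assumes "q $ None \<noteq> 0"
  shows "of_int (q $ None) * (int_linear (\<chi> i. a $ Some i) (affine_point q) + of_int (a $ None))
       = of_int (\<Sum>j\<in>UNIV. a $ j * q $ j)"
  using assms
  by (simp add: int_linear_def affine_point_def sum_option distrib_left sum_distrib_left)

lemma affine_point_surj:
  fixes y :: "real ^ 'n"
  assumes "\<And>i. y $ i \<in> \<rat>"
  obtains q where "q $ None > 0" "affine_point q = y"
proof -
  have "\<exists>n d. d > 0 \<and> y $ i = of_int n / of_int d" for i
    using assms[of i] by (metis Rats_cases')
  then obtain n d where nd: "\<And>i. d i > 0" "\<And>i. y $ i = of_int (n i) / of_int (d i)"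
    by metis
  \<comment> \<open>A common denominator: splitting off the factor \<open>d i\<close> shows that
    each \<open>y $ i * of_int s\<close> is an integer.\<close>
  define s where "s = (\<Prod>i\<in>UNIV. d i)"
  have s: "s > 0"
    using nd(1) by (simp add: s_def prod_pos)
  have sd: "s = d i * (\<Prod>j\<in>UNIV - {i}. d j)" for i
    by (simp add: s_def prod.remove)
  have y: "y $ i * of_int s = of_int (n i * (\<Prod>j\<in>UNIV - {i}. d j))" for i
    using nd(1)[of i] by (subst sd[of i]) (simp add: nd(2))
  obtain c where c: "\<And>i. y $ i * of_int s = of_int (c i)"
    using y by (rule that)
  show ?thesis
  proof
    let ?q = "\<chi> j. case j of None \<Rightarrow> s | Some i \<Rightarrow> c i"
    show "?q $ None > 0"
      using s by simp
    show "affine_point ?q = y"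
      using s by (simp add: vec_eq_iff affine_point_def c[symmetric])
  qed
qed

text \<open>Adding homogeneous vectors forms the mediant, a convex combination weighted by the
  denominators. This is how convexity becomes subadditivity.\<close>

lemma affine_point_add:
  assumes "q $ None > 0" "r $ None > 0"
  defines "t \<equiv> of_int (r $ None) / of_int (q $ None + r $ None)"
  shows "affine_point (q + r) = (1 - t) *\<^sub>R affine_point q + t *\<^sub>R affine_point r"
proof -
  have "1 - t = of_int (q $ None) / of_int (q $ None + r $ None)"
    using assms(1,2) by (simp add: t_def field_simps)
  then show ?thesis
    using assms(1,2) by (simp add: vec_eq_iff affine_point_def t_def add_divide_distrib)
qed

lemma affine_point_scale: "n \<noteq> 0 \<Longrightarrow> affine_point (n *s q) = affine_point q"
  unfolding affine_point_def by simp

text \<open>Dividing numerator and denominator by \<open>k\<close> leaves \<open>q\<close> a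
  contribution of order \<open>1 / k\<close>. The limit turns topological interiority into
  absorption by the cone.\<close>

lemma affine_point_tendsto:
  assumes "p $ None > 0"
  shows "(\<lambda>k. affine_point (int k *s p + q)) \<longlonglongrightarrow> affine_point p"
proof (rule vec_tendstoI)
  fix i
  have "(\<lambda>k. (of_int (p $ Some i) + of_int (q $ Some i) / real k) /
             (of_int (p $ None) + of_int (q $ None) / real k))
        \<longlonglongrightarrow> (of_int (p $ Some i) + 0) / (of_int (p $ None) + 0)"
    using assms by (intro tendsto_intros lim_const_over_n) auto
  moreover have "\<forall>\<^sub>F k in sequentially.
      (of_int (p $ Some i) + of_int (q $ Some i) / real k) /
        (of_int (p $ None) + of_int (q $ None) / real k) = affine_point (int k *s p + q) $ i"
    using eventually_gt_at_top[of 0]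
  proof eventually_elim
    case (elim k)
    have "(of_int (p $ Some i) + of_int (q $ Some i) / real k) /
        (of_int (p $ None) + of_int (q $ None) / real k)
      = (real k * (of_int (p $ Some i) + of_int (q $ Some i) / real k)) /
        (real k * (of_int (p $ None) + of_int (q $ None) / real k))"
      using elim by simp
    also have "\<dots> = affine_point (int k *s p + q) $ i"
      using elim by (simp add: affine_point_def distrib_left)
    finally show ?case .
  qed
  ultimately show "(\<lambda>k. affine_point (int k *s p + q) $ i) \<longlonglongrightarrow> affine_point p $ i"
    by (simp add: affine_point_def filterlim_cong[OF refl refl])
qed

section \<open>Integral supports at rational points\<close>

text \<open>\<open>K\<close> is the cone of lattice vectors over \<open>D\<close> and
  \<open>F\<close> the perspective of \<open>g\<close>. A support of \<open>F\<close> at a vector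
  representing \<open>x\<close> dehomogenises to one of \<open>g\<close>, so far only below
  \<open>g\<close> at rational points, as these alone have lattice representatives.\<close>

lemma rational_point_integral_support:
  fixes g :: "real ^ 'n \<Rightarrow> real"
  assumes convex: "convex_on D g"
    and integral: "\<And>x. x \<in> D \<Longrightarrow> (\<forall>i. x $ i \<in> \<rat>) \<Longrightarrow> g x \<in> int_combinations x"
    and x: "x \<in> interior D" "\<And>i. x $ i \<in> \<rat>"
  obtains a b where "int_linear a x + of_int b = g x"
    and "\<And>y. y \<in> D \<Longrightarrow> (\<forall>i. y $ i \<in> \<rat>) \<Longrightarrow> int_linear a y + of_int b \<le> g y"
proof -
  define K where "K = {q :: int ^ ('n::finite option). q $ None > 0 \<and> affine_point q \<in> D}"
  \<comment> \<open>The floor only provides the type \<open>int\<close>: on \<open>K\<close> the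
    product is already an integer, since clearing the denominator of an integral combination leaves
    an integer.\<close>
  define F where "F q = \<lfloor>of_int (q $ None) * g (affine_point q)\<rfloor>" for q
  have F: "of_int (F q) = of_int (q $ None) * g (affine_point q)" if q: "q \<in> K" for q
  proof -
    have "\<forall>i. affine_point q $ i \<in> \<rat>"
      by (simp add: affine_point_def)
    then obtain a b where ab: "g (affine_point q) = int_linear a (affine_point q) + of_int b"
      using integral[of "affine_point q"] q unfolding K_def int_combinations_def by blast
    let ?c = "\<chi> j. case j of None \<Rightarrow> b | Some i \<Rightarrow> a $ i"
    have "of_int (q $ None) * g (affine_point q) = of_int (\<Sum>j\<in>UNIV. ?c $ j * q $ j)"
      using int_linear_affine_point[of q ?c] q by (simp add: K_def ab)
    then show ?thesis
      unfolding F_def by (metis floor_of_int)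
  qed
  have "sublinear_on K F"
    unfolding sublinear_on_def
  proof (intro conjI ballI allI impI)
    fix q r assume q: "q \<in> K" and r: "r \<in> K"
    define s where "s = real_of_int (q $ None)"
    define t where "t = real_of_int (r $ None)"
    have st: "s > 0" "t > 0"
      using q r by (auto simp: s_def t_def K_def)
    have pt: "affine_point (q + r) = (1 - t / (s + t)) *\<^sub>R affine_point q + (t / (s + t)) *\<^sub>R affine_point r"
      using affine_point_add[of q r] q r by (simp add: K_def s_def t_def)
    have "affine_point (q + r) \<in> D"
      unfolding pt using q r st convex_on_imp_convex[OF convex]
      by (intro convexD_alt) (auto simp: K_def)
    then show qr: "q + r \<in> K"
      using q r by (simp add: K_def)
    have "g (affine_point (q + r))
        \<le> (1 - t / (s + t)) * g (affine_point q) + (t / (s + t)) * g (affine_point r)"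
      unfolding pt using q r st
      by (intro convex_onD[OF convex]) (auto simp: K_def)
    then have "(s + t) * g (affine_point (q + r))
        \<le> (s + t) * ((1 - t / (s + t)) * g (affine_point q) + (t / (s + t)) * g (affine_point r))"
      using st by (intro mult_left_mono) auto
    also have "\<dots> = s * g (affine_point q) + t * g (affine_point r)"
    proof -
      have "(s + t) * (1 - t / (s + t)) = s" "(s + t) * (t / (s + t)) = t"
        using st by (simp_all add: field_simps)
      then show ?thesis
        by (metis distrib_left mult.assoc)
    qed
    finally have "of_int (F (q + r)) \<le> real_of_int (F q + F r)"
      using F[OF q] F[OF r] F[OF qr] by (simp add: s_def t_def)
    then show "F (q + r) \<le> F q + F r"
      by linarith
  next
    fix q and n :: int assume q: "q \<in> K" and n: "n > 0"
    then show nq: "n *s q \<in> K"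
      by (simp add: K_def affine_point_scale)
    have "of_int (F (n *s q)) = real_of_int (n * F q)"
      using F[OF q] F[OF nq] n by (simp add: affine_point_scale)
    then show "F (n *s q) = n * F q"
      by linarith
  qed
  moreover obtain p where p: "p $ None > 0" "affine_point p = x"
    using affine_point_surj[OF x(2)] .
  moreover have "\<forall>\<^sub>F k in sequentially. int k *s p + q \<in> K" for q
  proof -
    have "\<forall>\<^sub>F k in sequentially. affine_point (int k *s p + q) \<in> interior D"
      using topological_tendstoD[OF affine_point_tendsto[OF p(1)]] p(2) x(1) by auto
    then show ?thesis
      \<comment> \<open>As \<open>p $ None \<ge> 1\<close>, such \<open>k\<close> keep the
        denominator of \<open>int k *s p + q\<close> positive.\<close>
      using eventually_gt_at_top[of "nat \<bar>q $ None\<bar>"]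
    proof eventually_elim
      case (elim k)
      have "int k * 1 \<le> int k * p $ None"
        using p(1) by (intro mult_left_mono) auto
      moreover have "\<bar>q $ None\<bar> < int k"
        using elim(2) by linarith
      ultimately have "int k * p $ None + q $ None > 0"
        by linarith
      then show ?case
        using elim(1) interior_subset[of D] by (auto simp: K_def)
    qed
  qed
  moreover have "p \<in> K"
    using p x(1) interior_subset[of D] by (auto simp: K_def)
  ultimately obtain a where a: "(\<Sum>i\<in>UNIV. a $ i * p $ i) = F p"
      "\<And>q. q \<in> K \<Longrightarrow> (\<Sum>i\<in>UNIV. a $ i * q $ i) \<le> F q"
    using sublinear_integral_support[of K F p] by blast
  show ?thesis
  proof
    let ?l = "\<lambda>y. int_linear (\<chi> i. a $ Some i) y + of_int (a $ None)"
    have "of_int (p $ None) * ?l x = of_int (p $ None) * g x"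
      using int_linear_affine_point[of p a] F[OF \<open>p \<in> K\<close>] a(1) p by simp
    then show "?l x = g x"
      using p(1) by simp
    fix y assume y: "y \<in> D" "\<forall>i. y $ i \<in> \<rat>"
    obtain q where q: "q $ None > 0" "affine_point q = y"
      using affine_point_surj[of y] y(2) by auto
    then have "q \<in> K"
      using y(1) by (simp add: K_def)
    have "of_int (q $ None) * ?l y = of_int (\<Sum>i\<in>UNIV. a $ i * q $ i)"
      using int_linear_affine_point[of q a] q by simp
    also have "\<dots> \<le> of_int (q $ None) * g y"
      using a(2)[OF \<open>q \<in> K\<close>] F[OF \<open>q \<in> K\<close>] q(2) by (metis of_int_le_iff)
    finally show "?l y \<le> g y"
      using q(1) by simp
  qed
qed

section \<open>Density of the rational points\<close>

lemma closure_rational_vectors: "closure {x :: real ^ 'n. \<forall>i. x $ i \<in> \<rat>} = UNIV"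
proof -
  have "\<exists>r. (\<forall>i. r $ i \<in> \<rat>) \<and> dist r x < e" if "e > 0" for x :: "real ^ 'n" and e
  proof -
    have "\<exists>r\<in>\<rat>. \<bar>r - x $ i\<bar> < e / real CARD('n)" for i
      using rational_approximation[of "e / real CARD('n)" "x $ i"] \<open>e > 0\<close> by auto
    then obtain r where r: "\<And>i. r i \<in> \<rat>" "\<And>i. \<bar>r i - x $ i\<bar> < e / real CARD('n)"
      by metis
    have "dist (\<chi> i. r i) x \<le> (\<Sum>i\<in>UNIV. \<bar>r i - x $ i\<bar>)"
      using norm_le_l1_cart[of "(\<chi> i. r i) - x"] by (simp add: dist_norm)
    also have "\<dots> < (\<Sum>i\<in>(UNIV :: 'n set). e / real CARD('n))"
      using r(2) by (intro sum_strict_mono) auto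
    finally show ?thesis
      using r(1) by (intro exI[of _ "\<chi> i. r i"]) simp
  qed
  then show ?thesis
    by (auto simp: closure_approachable)
qed

text \<open>Rational points are dense in the open set \<open>S\<close>. Closedness is relative to
  \<open>S\<close> because the sets in question are cut out by functions continuous on
  \<open>S\<close> alone.\<close>

lemma subset_closedin_if_rational_subset:
  fixes S :: "(real ^ 'n) set"
  assumes "open S" "closedin (top_of_set S) T" "\<And>x. x \<in> S \<Longrightarrow> (\<forall>i. x $ i \<in> \<rat>) \<Longrightarrow> x \<in> T"
  shows "S \<subseteq> T"
proof -
  obtain T' where T': "closed T'" "T = S \<inter> T'"
    using assms(2) by (auto simp: closedin_closed)
  have "S \<subseteq> closure (S \<inter> {x. \<forall>i. x $ i \<in> \<rat>})"
    using open_Int_closure_subset[OF assms(1)] closure_rational_vectors by fastforce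
  also have "\<dots> \<subseteq> T'"
    using assms(3) T' by (intro closure_minimal) auto
  finally show ?thesis
    using T'(2) by blast
qed

section \<open>Finiteness of the integral supports, locally and on compact sets\<close>

lemma continuous_on_int_linear [continuous_intros]: "continuous_on S (int_linear a)"
  unfolding int_linear_def by (intro continuous_intros)

lemma int_linear_axis_add: "int_linear a (x + t *\<^sub>R axis i 1) = int_linear a x + t * of_int (a $ i)"
proof -
  have "(\<Sum>j\<in>UNIV. of_int (a $ j) * (t * axis i 1 $ j)) = (\<Sum>j\<in>UNIV. if j = i then of_int (a $ i) * t else 0)"
    by (intro sum.cong) (auto simp: axis_def)
  then show ?thesis
    by (simp add: int_linear_def distrib_left sum.distrib)
qed

lemma finite_bounded_int_vectors: "finite {a :: int ^ 'n. \<forall>i. \<bar>a $ i\<bar> \<le> N}"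
proof (rule finite_subset)
  show "finite (vec_lambda ` (UNIV \<rightarrow>\<^sub>E {- N..N}) :: (int ^ 'n) set)"
    by (intro finite_imageI finite_PiE) auto
  show "{a :: int ^ 'n. \<forall>i. \<bar>a $ i\<bar> \<le> N} \<subseteq> vec_lambda ` (UNIV \<rightarrow>\<^sub>E {- N..N})"
  proof
    fix a :: "int ^ 'n" assume "a \<in> {a. \<forall>i. \<bar>a $ i\<bar> \<le> N}"
    then have "vec_nth a \<in> UNIV \<rightarrow>\<^sub>E {- N..N}"
      by (auto simp: abs_le_iff minus_le_iff)
    then show "a \<in> vec_lambda ` (UNIV \<rightarrow>\<^sub>E {- N..N})"
      by (metis image_eqI vec_nth_inverse)
  qed
qed

text \<open>
  Requiring contact with \<open>g\<close> makes \<open>b\<close> a function of \<open>a\<close>, so the bound on \<open>a\<close> suffices for finiteness.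
\<close>

definition bounded_supports :: "(real ^ 'n) set \<Rightarrow> (real ^ 'n \<Rightarrow> real) \<Rightarrow> int \<Rightarrow> ((int ^ 'n) \<times> int) set" where
  "bounded_supports S g N = {(a, b). (\<forall>i. \<bar>a $ i\<bar> \<le> N) \<and>
     (\<forall>x\<in>S. int_linear a x + of_int b \<le> g x) \<and> (\<exists>x\<in>S. int_linear a x + of_int b = g x)}"

lemma finite_bounded_supports: "finite (bounded_supports S g N)"
proof (rule finite_imageD[of fst])
  show "finite (fst ` bounded_supports S g N)"
    by (rule finite_subset[OF _ finite_bounded_int_vectors[of N]]) (auto simp: bounded_supports_def)
  show "inj_on fst (bounded_supports S g N)"
  proof (rule inj_onI, clarsimp)
    fix a b b' assume ab: "(a, b) \<in> bounded_supports S g N" "(a, b') \<in> bounded_supports S g N"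
    obtain x x' where x: "x \<in> S" "int_linear a x + of_int b = g x"
      and x': "x' \<in> S" "int_linear a x' + of_int b' = g x'"
      using ab unfolding bounded_supports_def by auto
    \<comment> \<open>Each functional is tested at the contact point of the other, giving
      \<open>b' \<le> b\<close> and \<open>b \<le> b'\<close>.\<close>
    have "int_linear a x + of_int b' \<le> g x" "int_linear a x' + of_int b \<le> g x'"
      using ab x(1) x'(1) by (auto simp: bounded_supports_def)
    with x(2) x'(2) show "b = b'"
      by linarith
  qed
qed

text \<open>Boundedness of \<open>g\<close> near \<open>y\<close> bounds the slopes, so finitely
  many functionals serve all rational points of the ball. Their contact set is relatively closed and
  hence is the whole ball.\<close>

lemma locally_bounded_supports:
  fixes g :: "real ^ 'n \<Rightarrow> real"
  assumes S: "open S" "y \<in> S" and cont: "continuous_on S g"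
    and supp: "\<And>x. x \<in> S \<Longrightarrow> (\<forall>i. x $ i \<in> \<rat>) \<Longrightarrow>
      \<exists>a b. int_linear a x + of_int b = g x \<and> (\<forall>z\<in>S. int_linear a z + of_int b \<le> g z)"
  shows "\<exists>e>0. \<exists>N. \<forall>x\<in>ball y e. \<exists>(a, b)\<in>bounded_supports S g N. int_linear a x + of_int b = g x"
proof -
  obtain r where r: "r > 0" "cball y r \<subseteq> S"
    using S by (auto simp: open_contains_cball)
  \<comment> \<open>Halving leaves room for a step of length \<open>e\<close> from any point of
    \<open>ball y e\<close> inside a compact ball where \<open>g\<close> is bounded.\<close>
  define e where "e = r / 2"
  have e: "e > 0" "cball y (2 * e) \<subseteq> S"
    using r by (auto simp: e_def)
  have "bounded (g ` cball y (2 * e))"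
    using cont e(2) by (intro compact_imp_bounded compact_continuous_image)
      (auto intro: continuous_on_subset)
  then obtain M where M: "\<And>x. x \<in> cball y (2 * e) \<Longrightarrow> \<bar>g x\<bar> \<le> M"
    unfolding bounded_iff by (metis imageI real_norm_def)
  define N where "N = \<lceil>2 * M / e\<rceil>"
  have ball: "ball y e \<subseteq> S"
    using e by (auto simp: subset_iff)
  define T where "T = (\<Union>(a, b)\<in>bounded_supports S g N.
      ball y e \<inter> (\<lambda>x. int_linear a x + of_int b - g x) -` {0})"
  have "ball y e \<subseteq> T"
  proof (rule subset_closedin_if_rational_subset)
    have "continuous_on (ball y e) g"
      using cont ball continuous_on_subset by blast
    then show "closedin (top_of_set (ball y e)) T"
      unfolding T_def using finite_bounded_supports[of S g N]
      by (intro closedin_Union finite_imageI)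
        (auto intro!: continuous_closedin_preimage continuous_intros)
  next
    fix x assume x: "x \<in> ball y e" "\<forall>i. x $ i \<in> \<rat>"
    then obtain a b where ab: "int_linear a x + of_int b = g x"
      "\<And>z. z \<in> S \<Longrightarrow> int_linear a z + of_int b \<le> g z"
      using supp ball by blast
    \<comment> \<open>After a step \<open>t\<close> along an axis the support is still below
      \<open>g\<close>, which has changed by at most \<open>2 * M\<close>. Both signs of
      \<open>t\<close> together bound the absolute slope.\<close>
    have "t * of_int (a $ i) \<le> 2 * M" if "\<bar>t\<bar> = e" for t i
    proof -
      have "dist y (x + t *\<^sub>R axis i 1) \<le> dist y x + dist x (x + t *\<^sub>R axis i 1)"
        by (rule dist_triangle)
      also have "\<dots> \<le> 2 * e"
        using x(1) that by (simp add: dist_norm)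
      finally have mem: "x + t *\<^sub>R axis i 1 \<in> cball y (2 * e)"
        by simp
      then have "int_linear a x + t * of_int (a $ i) + of_int b \<le> g (x + t *\<^sub>R axis i 1)"
        using ab(2)[of "x + t *\<^sub>R axis i 1"] e(2) by (auto simp: int_linear_axis_add)
      then show ?thesis
        using ab(1) M[OF mem] M[of x] x(1) e(1) by auto
    qed
    from this[of e] this[of "- e"] have "e * \<bar>of_int (a $ i)\<bar> \<le> 2 * M" for i
      using e(1) by (simp add: abs_if)
    then have "\<bar>real_of_int (a $ i)\<bar> \<le> 2 * M / e" for i
      using e(1) by (simp add: field_simps)
    then have "\<bar>a $ i\<bar> \<le> N" for i
      unfolding N_def by (metis le_ceiling_iff of_int_abs ceiling_mono ceiling_of_int)
    then have "(a, b) \<in> bounded_supports S g N"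
      using ab x(1) ball by (auto simp: bounded_supports_def)
    then show "x \<in> T"
      using x(1) ab(1) by (force simp: T_def)
  qed simp
  then have "\<exists>(a, b)\<in>bounded_supports S g N. int_linear a x + of_int b = g x" if "x \<in> ball y e" for x
    using that unfolding T_def by fastforce
  then show ?thesis
    using e(1) by blast
qed

text \<open>The local families are joined along a finite subcover of \<open>C\<close>. Every member
  lies below \<open>g\<close> on the whole interior of \<open>D\<close>, so joining them preserves
  the lower bound.\<close>

lemma finite_integral_supports_on_compact:
  fixes g :: "real ^ 'n \<Rightarrow> real"
  assumes convex: "convex_on D g"
    and integral: "\<And>x. x \<in> D \<Longrightarrow> (\<forall>i. x $ i \<in> \<rat>) \<Longrightarrow> g x \<in> int_combinations x"
    and C: "compact C" "C \<subseteq> interior D"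
  obtains A :: "((int ^ 'n) \<times> int) set" where "finite A" "A \<noteq> {}"
    "\<And>x a b. x \<in> C \<Longrightarrow> (a, b) \<in> A \<Longrightarrow> int_linear a x + of_int b \<le> g x"
    "\<And>x. x \<in> C \<Longrightarrow> \<exists>(a, b)\<in>A. int_linear a x + of_int b = g x"
proof (cases "C = {}")
  case True
  \<comment> \<open>For empty \<open>C\<close> any functional serves; zero makes \<open>A\<close>
    nonempty.\<close>
  then show ?thesis
    by (intro that[of "{(0, 0)}"]) auto
next
  case False
  let ?S = "interior D"
  have "convex_on ?S g"
    using convex_on_subset[OF convex interior_subset] convex_on_imp_convex[OF convex]
    by (simp add: convex_interior)
  then have cont: "continuous_on ?S g"
    by (intro convex_on_continuous) auto
  have "\<exists>a b. int_linear a x + of_int b = g x \<and> (\<forall>z\<in>?S. int_linear a z + of_int b \<le> g z)"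
    if x: "x \<in> ?S" "\<forall>i. x $ i \<in> \<rat>" for x
  proof -
    obtain a b where ab: "int_linear a x + of_int b = g x"
      "\<And>y. y \<in> D \<Longrightarrow> (\<forall>i. y $ i \<in> \<rat>) \<Longrightarrow> int_linear a y + of_int b \<le> g y"
      using rational_point_integral_support[OF convex integral x(1)] x(2) by blast
    \<comment> \<open>The set where the support inequality holds is relatively closed and contains
      the rational points, so the inequality extends to the whole interior.\<close>
    have "?S \<subseteq> ?S \<inter> (\<lambda>z. g z - (int_linear a z + of_int b)) -` {0..}"
      using ab(2) interior_subset
      by (intro subset_closedin_if_rational_subset continuous_closedin_preimage continuous_intros cont)
        auto
    then show ?thesis
      using ab(1) by (auto simp: subset_iff)
  qed
  then have "\<exists>e>0. \<exists>N. \<forall>x\<in>ball y e. \<exists>(a, b)\<in>bounded_supports ?S g N. int_linear a x + of_int b = g x"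
    if "y \<in> ?S" for y
    using locally_bounded_supports[OF open_interior that cont] by blast
  then obtain e N where eN: "\<And>y. y \<in> ?S \<Longrightarrow> e y > 0"
    "\<And>y x. y \<in> ?S \<Longrightarrow> x \<in> ball y (e y) \<Longrightarrow>
      \<exists>(a, b)\<in>bounded_supports ?S g (N y). int_linear a x + of_int b = g x"
    by metis
  obtain C' where C': "C' \<subseteq> C" "finite C'" "C \<subseteq> (\<Union>y\<in>C'. ball y (e y))"
  proof (rule compactE_image[OF C(1), of C "\<lambda>y. ball y (e y)"])
    show "C \<subseteq> (\<Union>y\<in>C. ball y (e y))"
      using C(2) eN(1) centre_in_ball by blast
  qed auto
  define A where "A = (\<Union>y\<in>C'. bounded_supports ?S g (N y))"
  have touch: "\<exists>(a, b)\<in>A. int_linear a x + of_int b = g x" if "x \<in> C" for x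
  proof -
    obtain y where "y \<in> C'" "x \<in> ball y (e y)"
      using C'(3) \<open>x \<in> C\<close> by blast
    then show ?thesis
      using eN(2)[of y x] C'(1) C(2) unfolding A_def by blast
  qed
  show ?thesis
  proof
    show "finite A"
      using C'(2) by (simp add: A_def finite_bounded_supports)
    show "A \<noteq> {}"
      using touch False by blast
    show "int_linear a x + of_int b \<le> g x" if "x \<in> C" "(a, b) \<in> A" for x a b
      using that C(2) by (auto simp: A_def bounded_supports_def)
  qed (use touch in blast)
qed

section \<open>Closedness and assembly of polyhedral functions\<close>

lemma closed_integral_gen_affine_le:
  fixes g :: "real ^ 'n \<Rightarrow> ereal"
  assumes "integral_gen_affine g"
  shows "closed {x. g x \<le> 0}"
proof -
  have affine: "closed {x. l x \<le> 0}" if l: "integral_affine l" for l :: "real ^ 'n \<Rightarrow> ereal"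
  proof -
    obtain a b where "l = (\<lambda>x. ereal (int_linear a x + of_int b))"
      using l by (auto simp: integral_affine_def)
    then show ?thesis
      by (auto intro!: closed_Collect_le continuous_intros simp: zero_ereal_def)
  qed
  show ?thesis
    using assms unfolding integral_gen_affine_def
  proof (elim disjE exE conjE)
    fix l and a :: "int ^ 'n" and b
    assume l: "integral_affine l" and g: "g = (\<lambda>x. l x + delta (int_halfspace a b) x)"
    have "{x. g x \<le> 0} = {x. l x \<le> 0} \<inter> int_halfspace a b"
      using l by (auto simp: g delta_def integral_affine_def)
    moreover have "closed (int_halfspace a b)"
      unfolding int_halfspace_def by (intro closed_Collect_le continuous_intros)
    ultimately show ?thesis
      using affine[OF l] by auto
  qed (rule affine)
qed

text \<open>\<open>C\<close> is the sublevel set of \<open>delta C\<close> at 0, and a finite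
  maximum is at most 0 exactly when all members are. With boundedness this gives
  compactness.\<close>

lemma closed_rational_polyhedral:
  assumes "rational_polyhedral C"
  shows "closed C"
proof -
  obtain G where G: "finite G" "G \<noteq> {}" "\<And>g. g \<in> G \<Longrightarrow> integral_gen_affine g"
    and eq: "delta C = (\<lambda>x. MAX g\<in>G. g x)"
    using assms unfolding rational_polyhedral_def integral_polyhedral_def by blast
  have "x \<in> C \<longleftrightarrow> (\<forall>g\<in>G. g x \<le> 0)" for x
  proof -
    have "x \<in> C \<longleftrightarrow> delta C x \<le> 0"
      by (simp add: delta_def)
    also have "\<dots> \<longleftrightarrow> (\<forall>g\<in>G. g x \<le> 0)"
      using G(1,2) by (simp add: eq)
    finally show ?thesis .
  qed
  then have "C = (\<Inter>g\<in>G. {x. g x \<le> 0})"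
    by blast
  then show ?thesis
    using G(3) closed_integral_gen_affine_le by auto
qed

text \<open>Only \<open>g\<close> may carry a half-space: two half-spaces would in general leave the
  class.\<close>

lemma integral_gen_affine_add:
  fixes l g :: "real ^ 'n \<Rightarrow> ereal"
  assumes "integral_affine l" "integral_gen_affine g"
  shows "integral_gen_affine (\<lambda>x. l x + g x)"
proof -
  have affine: "integral_affine (\<lambda>x. l x + k x)" if k: "integral_affine k" for k
  proof -
    obtain a b where l: "l = (\<lambda>x. ereal (int_linear a x + of_int b))"
      using assms(1) unfolding integral_affine_def by blast
    obtain a' b' where "k = (\<lambda>x. ereal (int_linear a' x + of_int b'))"
      using k unfolding integral_affine_def by blast
    then have "(\<lambda>x. l x + k x) = (\<lambda>x. ereal (int_linear (a + a') x + of_int (b + b')))"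
      by (auto simp: l int_linear_def algebra_simps sum.distrib)
    then show ?thesis
      unfolding integral_affine_def by blast
  qed
  show ?thesis
    using assms(2) unfolding integral_gen_affine_def
  proof (elim disjE exE conjE)
    fix k and a :: "int ^ 'n" and b
    assume k: "integral_affine k" "a \<noteq> 0" "g = (\<lambda>x. k x + delta (int_halfspace a b) x)"
    then have "(\<lambda>x. l x + g x) = (\<lambda>x. (l x + k x) + delta (int_halfspace a b) x)"
      by (simp add: add.assoc)
    then show "integral_affine (\<lambda>x. l x + g x) \<or> (\<exists>k a b. integral_affine k \<and> a \<noteq> 0 \<and>
        (\<lambda>x. l x + g x) = (\<lambda>x. k x + delta (int_halfspace a b) x))"
      using affine[OF k(1)] k(2) by blast
  qed (use affine in blast)
qed

text \<open>Maxima over independent choices add, so the maximum over all sums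
  \<open>l x + g x\<close> is taken. On \<open>C\<close> the two maxima are \<open>f x\<close> and
  0; off \<open>C\<close> some \<open>g x\<close> is infinite.\<close>

lemma integral_polyhedral_add_delta:
  assumes C: "rational_polyhedral C" and f: "\<And>x. f x \<noteq> - \<infinity>"
    and L: "finite L" "L \<noteq> {}" "\<And>l. l \<in> L \<Longrightarrow> integral_affine l"
    and le: "\<And>x l. x \<in> C \<Longrightarrow> l \<in> L \<Longrightarrow> l x \<le> f x"
    and touch: "\<And>x. x \<in> C \<Longrightarrow> \<exists>l\<in>L. l x = f x"
  shows "integral_polyhedral (\<lambda>x. f x + delta C x)"
proof -
  obtain G where G: "finite G" "G \<noteq> {}" "\<And>g. g \<in> G \<Longrightarrow> integral_gen_affine g"
    and eq: "delta C = (\<lambda>x. MAX g\<in>G. g x)"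
    using C unfolding rational_polyhedral_def integral_polyhedral_def by blast
  define H where "H = (\<lambda>(l, g) x. l x + g x) ` (L \<times> G)"
  have "f x + delta C x = (MAX h\<in>H. h x)" for x
  proof (rule Max_eqI[symmetric])
    show "finite ((\<lambda>h. h x) ` H)"
      using L(1) G(1) by (simp add: H_def)
    show "y \<le> f x + delta C x" if y: "y \<in> (\<lambda>h. h x) ` H" for y
    proof (cases "x \<in> C")
      case True
      obtain l g where lg: "l \<in> L" "g \<in> G" "y = l x + g x"
        using y unfolding H_def by auto
      have "g x \<le> delta C x"
        using lg(2) G(1) by (simp add: eq)
      then show ?thesis
        using le[OF True lg(1)] lg(3) by (simp add: add_mono)
    next
      case False
      then show ?thesis
        using f[of x] by (simp add: delta_def)
    qed
    have "delta C x \<in> (\<lambda>g. g x) ` G"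
      unfolding eq using G(1,2) by (intro Max_in) auto
    then obtain g where g: "g \<in> G" "g x = delta C x"
      by auto
    \<comment> \<open>Off \<open>C\<close> any \<open>l\<close> serves, as \<open>g x\<close> is
      infinite there.\<close>
    obtain l where l: "l \<in> L" "x \<in> C \<longrightarrow> l x = f x"
      using touch L(2) by blast
    have "l x \<noteq> - \<infinity>"
      using L(3)[OF l(1)] by (auto simp: integral_affine_def)
    then have "f x + delta C x = l x + g x"
      using g(2) l(2) f[of x] by (simp add: delta_def)
    then show "f x + delta C x \<in> (\<lambda>h. h x) ` H"
      using l(1) g(1) by (force simp: H_def)
  qed
  moreover have "finite H" "H \<noteq> {}" "\<forall>h\<in>H. integral_gen_affine h"
    using L G integral_gen_affine_add by (auto simp: H_def)
  ultimately show ?thesis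
    unfolding integral_polyhedral_def by blast
qed

section \<open>Passage from extended real to real values\<close>

lemma eff_dom_ereal:
  assumes "f x \<noteq> - \<infinity>" "x \<in> eff_dom f"
  shows "f x = ereal (real_of_ereal (f x))"
  using assms by (cases "f x") (auto simp: eff_dom_def)

text \<open>Between points of finite value the convexity bound is finite, which gives both convexity
  of the domain and the real inequality.\<close>

lemma convex_on_eff_dom:
  assumes f: "\<And>x. f x \<noteq> - \<infinity>" and convex: "ereal_convex f"
  shows "convex_on (eff_dom f) (\<lambda>x. real_of_ereal (f x))"
proof -
  have key: "t *\<^sub>R x + (1 - t) *\<^sub>R y \<in> eff_dom f \<and>
      real_of_ereal (f (t *\<^sub>R x + (1 - t) *\<^sub>R y)) \<le> t * real_of_ereal (f x) + (1 - t) * real_of_ereal (f y)"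
    if xy: "x \<in> eff_dom f" "y \<in> eff_dom f" and t: "0 \<le> t" "t \<le> 1" for x y t
  proof -
    obtain u v where uv: "f x = ereal u" "f y = ereal v"
      using eff_dom_ereal[of f x] eff_dom_ereal[of f y] f xy by blast
    have "f (t *\<^sub>R x + (1 - t) *\<^sub>R y) \<le> ereal t * f x + ereal (1 - t) * f y"
      using convex t by (simp add: ereal_convex_def)
    then have le: "f (t *\<^sub>R x + (1 - t) *\<^sub>R y) \<le> ereal (t * u + (1 - t) * v)"
      by (simp add: uv)
    then have "t *\<^sub>R x + (1 - t) *\<^sub>R y \<in> eff_dom f"
      by (auto simp: eff_dom_def intro: le_less_trans)
    with le show ?thesis
      using eff_dom_ereal[of f "t *\<^sub>R x + (1 - t) *\<^sub>R y"] f uv by (metis ereal_less_eq(3) real_of_ereal.simps(1))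
  qed
  show ?thesis
  proof (rule convex_onI)
    show "convex (eff_dom f)"
      unfolding convex_alt using key[of _ _ "1 - _"] by simp
    show "real_of_ereal (f ((1 - t) *\<^sub>R x + t *\<^sub>R y))
        \<le> (1 - t) * real_of_ereal (f x) + t * real_of_ereal (f y)"
      if "0 < t" "t < 1" "x \<in> eff_dom f" "y \<in> eff_dom f" for t x y
      using key[OF that(3,4), of "1 - t"] that(1,2) by simp
  qed
qed

theorem theorem2p14:
  fixes f :: "real ^ 'n \<Rightarrow> ereal"
  assumes "\<And>x. f x \<noteq> -\<infinity>"
    and "ereal_convex f"
    and "\<And>x. (\<forall>i. x $ i \<in> \<rat>) \<Longrightarrow> f x \<in> ereal ` int_combinations x \<union> {\<infinity>}"
  shows "internally_integral_polyhedral f"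
  unfolding internally_integral_polyhedral_def
proof (intro allI impI, elim conjE)
  fix C assume C: "bounded C" "rational_polyhedral C" "C \<subseteq> interior (eff_dom f)"
  have compact: "compact C"
    using C(1) closed_rational_polyhedral[OF C(2)] by (simp add: compact_eq_bounded_closed)
  \<comment> \<open>Membership in the effective domain excludes the alternative
    \<open>\<infinity>\<close>.\<close>
  have "real_of_ereal (f x) \<in> int_combinations x" if "x \<in> eff_dom f" "\<forall>i. x $ i \<in> \<rat>" for x
    using assms(3)[OF that(2)] that(1) by (auto simp: eff_dom_def)
  from finite_integral_supports_on_compact[OF convex_on_eff_dom[OF assms(1,2)] this compact C(3)]
  obtain A where A: "finite A" "A \<noteq> {}"
    "\<And>x a b. x \<in> C \<Longrightarrow> (a, b) \<in> A \<Longrightarrow> int_linear a x + of_int b \<le> real_of_ereal (f x)"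
    "\<And>x. x \<in> C \<Longrightarrow> \<exists>(a, b)\<in>A. int_linear a x + of_int b = real_of_ereal (f x)"
    by blast
  have f: "f x = ereal (real_of_ereal (f x))" if "x \<in> C" for x
    using that C(3) interior_subset[of "eff_dom f"] assms(1) eff_dom_ereal[of f x] by blast
  show "integral_polyhedral (\<lambda>x. f x + delta C x)"
  proof (rule integral_polyhedral_add_delta[OF C(2) assms(1)])
    let ?L = "(\<lambda>(a, b) x. ereal (int_linear a x + of_int b)) ` A"
    show "finite ?L" "?L \<noteq> {}"
      using A(1,2) by auto
    show "integral_affine l" if "l \<in> ?L" for l
      using that by (auto simp: integral_affine_def)
    show "l x \<le> f x" if "x \<in> C" "l \<in> ?L" for x l
      using that A(3)[OF that(1)] by (subst f[OF that(1)]) auto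
    show "\<exists>l\<in>?L. l x = f x" if "x \<in> C" for x
      using A(4)[OF that] by (subst f[OF that]) force
  qed
qed
end
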